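(* There is a constant $C'_n>0$ depending only on $n$ such that the following holds. Let $\Omega\subset\mathbb H^n$ be an open, horizontally bounded and (Euclidean) convex set. If $u:\overline\Omega\to\mathbb R$ is a continuous $H$-convex function with $u=0$ on $\partial\Omega$, then $$|u(\xi_0)|^{2n}\le C'_n\,\mathrm{dist}_H(\xi_0,\partial\Omega\cap H_{\xi_0})\,\mathrm{diam}_H(\Omega\cap H_{\xi_0})^{2n-1}\,\mathcal L^{2n}(\partial_Hu(\Omega\cap H_{\xi_0}))\qquad\forall\xi_0\in\Omega.$$
   Context: $\mathbb H^n=\mathbb C^n\times\mathbb R\cong\mathbb R^{2n+1}$ with real coordinates $(x,y,t)$, $z=x+iy$, group law $(z,t)\circ(z',t')=(z+z',t+t'+2\,\mathrm{Im}\langle z,z'\rangle)$, $\langle z,z'\rangle=\sum_j z_j\overline{z'_j}$. Dilations $\delta_\lambda(z,t)=(\lambda z,\lambda^2t)$. Horizontal plane at $\xi_0=(x_0,y_0,t_0)$: $H_{\xi_0}=\{(x,y,t):t=t_0+2(x\cdot y_0-x_0\cdot y)\}$. $\mathrm{Pr}_1(x,y,t)=(x,y)$. Gauge $N(z,t)=(|z|^4+t^2)^{1/4}$, $d_H(\xi,\zeta)=N(\zeta^{-1}\circ\xi)$, $\mathrm{dist}_H(\xi,A)=\inf_{\zeta\in A}d_H(\xi,\zeta)$, $\mathrm{diam}_H$ the $d_H$-diameter; $\Omega$ is horizontally bounded if $\sup\{\mathrm{diam}_H(\Omega\cap H_\xi):\xi\in\Omega\}<\infty$. A function $u$ on an $H$-convex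 set $\tilde\Omega$ is $H$-convex if $u(\xi_1\circ\delta_\lambda(\xi_1^{-1}\circ\xi_2))\le(1-\lambda)u(\xi_1)+\lambda u(\xi_2)$ for all $\xi_1,\xi_2\in\tilde\Omega$ with $\xi_1\in H_{\xi_2}$ and $\lambda\in[0,1]$. For $\xi\in\Omega$, $\partial_Hu(\xi)=\{p\in\mathbb R^{2n}:u(\zeta)\ge u(\xi)+p\cdot(\mathrm{Pr}_1(\zeta)-\mathrm{Pr}_1(\xi))\ \forall\zeta\in\Omega\cap H_\xi\}$, $\partial_Hu(E)=\bigcup_{\xi\in E}\partial_Hu(\xi)$; $\mathcal L^{2n}$ is Lebesgue measure on $\mathbb R^{2n}$. *)

theory Defs
  imports "HOL-Analysis.Analysis"
begin

type_synonym 'n hpt = "(real^'n) \<times> (real^'n) \<times> real"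

definition hmult :: "'n::finite hpt \<Rightarrow> 'n hpt \<Rightarrow> 'n hpt" where
  "hmult p q = (case p of (x,y,t) \<Rightarrow> (case q of (x',y',t') \<Rightarrow>
      (x + x', y + y', t + t' + 2 * (y \<bullet> x' - x \<bullet> y'))))"

definition hinv :: "'n::finite hpt \<Rightarrow> 'n hpt" where
  "hinv p = (case p of (x,y,t) \<Rightarrow> (-x, -y, -t))"

definition hdil :: "real \<Rightarrow> 'n::finite hpt \<Rightarrow> 'n hpt" where
  "hdil l p = (case p of (x,y,t) \<Rightarrow> (l *\<^sub>R x, l *\<^sub>R y, l^2 * t))"

definition hplane :: "'n::finite hpt \<Rightarrow> 'n hpt set" where
  "hplane p0 = (case p0 of (x0,y0,t0) \<Rightarrow>
      {(x,y,t). t = t0 + 2 * (x \<bullet> y0 - x0 \<bullet> y)})"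

definition Pr1 :: "'n::finite hpt \<Rightarrow> (real^'n) \<times> (real^'n)" where
  "Pr1 p = (case p of (x,y,t) \<Rightarrow> (x,y))"

definition gauge :: "'n::finite hpt \<Rightarrow> real" where
  "gauge p = (case p of (x,y,t) \<Rightarrow> root 4 ((norm x ^ 2 + norm y ^ 2) ^ 2 + t ^ 2))"

definition dH :: "'n::finite hpt \<Rightarrow> 'n hpt \<Rightarrow> real" where
  "dH p q = gauge (hmult (hinv q) p)"

definition distH :: "'n::finite hpt \<Rightarrow> 'n hpt set \<Rightarrow> real" where
  "distH p A = (INF q\<in>A. dH p q)"

definition diamH :: "'n::finite hpt set \<Rightarrow> real" where
  "diamH A = (SUP pq\<in>A \<times> A. dH (fst pq) (snd pq))"

definition horiz_bounded :: "'n::finite hpt set \<Rightarrow> bool" where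
  "horiz_bounded \<Omega> \<longleftrightarrow> (\<exists>M. \<forall>p\<in>\<Omega>. \<forall>a\<in>\<Omega> \<inter> hplane p. \<forall>b\<in>\<Omega> \<inter> hplane p. dH a b \<le> M)"

definition H_convex_fun :: "'n::finite hpt set \<Rightarrow> ('n hpt \<Rightarrow> real) \<Rightarrow> bool" where
  "H_convex_fun S u \<longleftrightarrow> (\<forall>p1\<in>S. \<forall>p2\<in>S. p1 \<in> hplane p2 \<longrightarrow>
     (\<forall>l\<in>{0..1}. u (hmult p1 (hdil l (hmult (hinv p1) p2))) \<le> (1 - l) * u p1 + l * u p2))"

definition H_subdiff :: "'n::finite hpt set \<Rightarrow> ('n hpt \<Rightarrow> real) \<Rightarrow> 'n hpt \<Rightarrow> ((real^'n) \<times> (real^'n)) set" where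
  "H_subdiff \<Omega> u p = {q. \<forall>z\<in>\<Omega> \<inter> hplane p. u z \<ge> u p + q \<bullet> (Pr1 z - Pr1 p)}"

definition H_subdiff_set :: "'n::finite hpt set \<Rightarrow> ('n hpt \<Rightarrow> real) \<Rightarrow> 'n hpt set \<Rightarrow> ((real^'n) \<times> (real^'n)) set" where
  "H_subdiff_set \<Omega> u E = (\<Union>p\<in>E. H_subdiff \<Omega> u p)"

text \<open>Lebesgue (outer) measure on R^{2n}; coincides with Lebesgue measure on measurable sets.\<close>
definition lebesgue_outer :: "('a::euclidean_space) set \<Rightarrow> ennreal" where
  "lebesgue_outer A = (INF B\<in>{B\<in>sets lebesgue. A \<subseteq> B}. emeasure lebesgue B)"

end

(*
  Identify the plane of p0 with R^(2n) and let D be the convex slice of Omega. If the affine function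
  with slope p vanishing at p0 stays below -u(p0) = |u(p0)| on the closure of D, then p is a horizontal
  subgradient at some point of D: points with a horizontal subgradient are dense in Omega, so the
  subgradients admit approximate continuous selections over D, to which Brouwer's theorem applies,
  and in the limit one gets v with p.(y - v) <= u(v^y) - u(v), where v^y is the point above y of the
  horizontal plane through v. Taking for y the base point p0 excludes boundary points v; taking
  y near v and using convexity on horizontal lines shows that p is a subgradient at v.
  The slopes p so obtained contain a tube of length ~ |u(p0)|/dist and radius ~ |u(p0)|/diam
  along the normal of a supporting hyperplane of D at a nearest boundary point.
*)

theory Submission
  imports Defs
begin

section \<open>Horizontal steps\<close>

text \<open>This is the group product of \<open>p\<close> with \<open>(w, 0)\<close>. For fixed
  \<open>p\<close> it is affine in the displacement \<open>w\<close>, so it parametrizes the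
  horizontal plane at \<open>p\<close> by R^(2n).\<close>

definition hstep :: "'n::finite hpt \<Rightarrow> (real^'n) \<times> (real^'n) \<Rightarrow> 'n hpt" where
  "hstep p w = (fst p + fst w, fst (snd p) + snd w,
     snd (snd p) + 2 * (fst w \<bullet> fst (snd p) - fst p \<bullet> snd w))"

lemma hplane_iff_hstep: "z \<in> hplane p \<longleftrightarrow> z = hstep p (Pr1 z - Pr1 p)"
  by (cases z; cases p) (auto simp: hplane_def hstep_def Pr1_def inner_diff inner_commute)

lemma hstep_in_hplane: "hstep p w \<in> hplane p"
  by (cases p) (auto simp: hplane_def hstep_def inner_add inner_commute)

lemma Pr1_hstep [simp]: "Pr1 (hstep p w) = Pr1 p + w"
  by (cases p; cases w) (simp add: hstep_def Pr1_def)

lemma hstep_0 [simp]: "hstep p 0 = p"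
  by (simp add: hstep_def)

lemma hstep_scaleR: "hstep p (s *\<^sub>R w) = p + s *\<^sub>R (hstep p w - p)"
  by (cases p; cases w) (simp add: hstep_def algebra_simps)

text \<open>Two horizontal steps usually compose to a point off the first plane; the error is the
  symplectic form of the two displacements, which vanishes for parallel ones.\<close>

lemma hstep_hstep_collinear: "hstep (hstep p (a *\<^sub>R w)) (b *\<^sub>R w) = hstep p ((a + b) *\<^sub>R w)"
  by (cases p; cases w) (simp add: hstep_def algebra_simps inner_commute)

lemma hplane_commute: "p \<in> hplane q \<longleftrightarrow> q \<in> hplane p"
  by (cases p; cases q) (auto simp: hplane_def inner_commute)

text \<open>Left translation by the inverse of \<open>p\<close> turns the step into
  \<open>(w, 0)\<close>, which the dilation merely scales. Hence H-convexity is ordinary convexity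
  along straight horizontal segments.\<close>

lemma hmult_hdil_hstep:
  "hmult p (hdil l (hmult (hinv p) (hstep p w))) = hstep p (l *\<^sub>R w)"
  by (cases p; cases w)
     (simp add: hstep_def hmult_def hdil_def hinv_def algebra_simps inner_commute)

text \<open>For two points on a common horizontal plane through one of them, the t-coordinate of the
  group quotient is zero, and the gauge reduces to the Euclidean norm of the rest.\<close>

lemma dH_hplane:
  assumes "q \<in> hplane p"
  shows "dH p q = norm (Pr1 q - Pr1 p)" "dH q p = norm (Pr1 q - Pr1 p)"
proof -
  have r: "root 4 ((x\<^sup>2 + y\<^sup>2)\<^sup>2) = sqrt (x\<^sup>2 + y\<^sup>2)" for x y :: real
  proof -
    have "(x\<^sup>2 + y\<^sup>2)\<^sup>2 = sqrt (x\<^sup>2 + y\<^sup>2) ^ 4"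
      by (simp add: power4_eq_xxxx power2_eq_square)
    then show ?thesis by (simp add: real_root_power_cancel)
  qed
  show "dH p q = norm (Pr1 q - Pr1 p)" "dH q p = norm (Pr1 q - Pr1 p)"
    using assms
    by (cases p; cases q; auto simp: hplane_def dH_def gauge_def hmult_def hinv_def Pr1_def
        norm_Pair r inner_commute norm_minus_commute algebra_simps)+
qed

lemma continuous_on_hstep [continuous_intros]:
  assumes "continuous_on S f" "continuous_on S g"
  shows "continuous_on S (\<lambda>x. hstep (f x) (g x))"
  unfolding hstep_def by (intro continuous_intros assms)

lemma H_convex_fun_hstep:
  assumes "H_convex_fun S u" "p \<in> S" "hstep p w \<in> S" "0 \<le> l" "l \<le> 1"
  shows "u (hstep p (l *\<^sub>R w)) \<le> (1 - l) * u p + l * u (hstep p w)"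
proof -
  have "p \<in> hplane (hstep p w)"
    using hplane_commute hstep_in_hplane by blast
  then show ?thesis
    using assms hmult_hdil_hstep[of p l w] unfolding H_convex_fun_def by (metis atLeastAtMost_iff)
qed

text \<open>The point \<open>p\<close> divides the horizontal segment between the two outer points
  in the ratio s : 1; the inequality is convexity there, multiplied by 1 + s.\<close>

lemma H_convex_fun_two_sided:
  assumes u: "H_convex_fun S u" and "hstep p (-(s *\<^sub>R w)) \<in> S" "hstep p w \<in> S" and s: "0 < s"
  shows "(1 + s) * u p \<le> u (hstep p (-(s *\<^sub>R w))) + s * u (hstep p w)"
proof -
  let ?q = "hstep p ((-s) *\<^sub>R w)"
  have q1: "hstep ?q ((1 + s) *\<^sub>R w) = hstep p w"
    by (simp only: hstep_hstep_collinear) simp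
  have q2: "hstep ?q ((s / (1 + s)) *\<^sub>R ((1 + s) *\<^sub>R w)) = p"
    using s by (simp only: hstep_hstep_collinear scaleR_scaleR) simp
  have "u p \<le> (1 - s / (1 + s)) * u ?q + s / (1 + s) * u (hstep p w)"
    using H_convex_fun_hstep[OF u, of ?q "(1 + s) *\<^sub>R w" "s / (1 + s)"] assms
    unfolding q1 q2 by simp
  also have "\<dots> = (u ?q + s * u (hstep p w)) / (1 + s)"
  proof -
    have "1 - s / (1 + s) = 1 / (1 + s)" using s by (simp add: field_simps)
    then show ?thesis by (simp add: add_divide_distrib)
  qed
  finally show ?thesis using s by (simp add: pos_le_divide_eq mult.commute)
qed

section \<open>Density of the points with a horizontal subgradient\<close>

text \<open>Where \<open>u\<close> is touched from above by a paraboloid, convexity along horizontal lines turns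
  the horizontal gradient of the paraboloid into a subgradient; such contact points
  arise by maximising \<open>u - k |\<cdot> - \<xi>|\<^sup>2\<close> near \<open>\<xi>\<close>.\<close>

lemma H_subdiff_nonempty_dense:
  fixes \<Omega> :: "'n::finite hpt set"
  assumes "open \<Omega>" and cont: "continuous_on \<Omega> u"
    and u: "H_convex_fun (closure \<Omega>) u" and "\<xi> \<in> \<Omega>" "0 < e"
  obtains m where "m \<in> \<Omega>" "dist m \<xi> < e" "H_subdiff \<Omega> u m \<noteq> {}"
proof -
  obtain r0 where r0: "r0 > 0" "cball \<xi> r0 \<subseteq> \<Omega>"
    using assms(1,4) open_contains_cball_eq by metis
  define r where "r = min r0 (e/2)"
  have r: "0 < r" "r < e" using r0(1) \<open>0 < e\<close> unfolding r_def by auto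
  have rsub: "cball \<xi> r \<subseteq> \<Omega>"
    using r0(2) subset_cball[of r r0 \<xi>] unfolding r_def by simp
  have cu: "continuous_on (cball \<xi> r) u"
    by (rule continuous_on_subset[OF cont rsub])
  have "bounded (u ` cball \<xi> r)"
    by (rule compact_imp_bounded[OF compact_continuous_image[OF cu compact_cball]])
  then obtain B where B: "\<And>x. x \<in> cball \<xi> r \<Longrightarrow> \<bar>u x\<bar> \<le> B"
    unfolding bounded_iff by (metis imageI real_norm_def)
  \<comment> \<open>On the sphere of radius \<open>r\<close> the penalty equals 2B + 1, more than
    the oscillation 2B of \<open>u\<close>, so the maximum of \<open>?h\<close> is attained inside
    the ball.\<close>
  define k where "k = (2 * B + 1) / r\<^sup>2"
  have kr: "k * r\<^sup>2 = 2 * B + 1" unfolding k_def using r by simp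
  let ?h = "\<lambda>x. u x - k * (norm (x - \<xi>))\<^sup>2"
  have "continuous_on (cball \<xi> r) ?h"
    by (intro continuous_intros cu)
  then obtain m where m: "m \<in> cball \<xi> r" and mmax: "\<And>x. x \<in> cball \<xi> r \<Longrightarrow> ?h x \<le> ?h m"
    using continuous_attains_sup[of "cball \<xi> r" ?h] r(1) by force
  have mr: "dist m \<xi> < r"
  proof (rule ccontr)
    assume "\<not> dist m \<xi> < r"
    then have "norm (m - \<xi>) = r" using m by (simp add: dist_norm norm_minus_commute)
    then have "?h \<xi> \<le> u m - (2 * B + 1)" using mmax[of \<xi>] r(1) kr by simp
    moreover have "u m \<le> B" "- B \<le> u \<xi>" using B[OF m] B[of \<xi>] r(1) by auto
    ultimately show False by simp
  qed
  define d where "d = m - \<xi>"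
  \<comment> \<open>This is the horizontal gradient at \<open>m\<close> of k |x - \<xi>|^2: the
    adjoint of the linear map w \<mapsto> \<open>hstep m w - m\<close> applied to 2k d.\<close>
  define q where "q = (2 * k) *\<^sub>R (fst d + (2 * snd (snd d)) *\<^sub>R fst (snd m),
      fst (snd d) - (2 * snd (snd d)) *\<^sub>R fst m)"
  have q: "q \<bullet> w = 2 * k * (d \<bullet> (hstep m w - m))" for w
    by (cases m; cases d; cases w)
       (simp add: q_def hstep_def algebra_simps inner_commute)
  have "q \<in> H_subdiff \<Omega> u m"
    unfolding H_subdiff_def
  proof safe
    fix z assume z: "z \<in> \<Omega>" "z \<in> hplane m"
    define w where "w = Pr1 z - Pr1 m"
    have zw: "hstep m w = z" using z(2) hplane_iff_hstep w_def by metis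
    let ?g = "z - m"
    \<comment> \<open>For small s > 0 the backward point \<open>m - s *\<^sub>R ?g\<close> stays in
      the ball, where the paraboloid bounds \<open>u\<close> from above. Convexity on the segment
      from there through \<open>m\<close> to \<open>z\<close> then bounds \<open>u z\<close> from
      below, with an error k s |g|^2 that vanishes as s tends to 0.\<close>
    have "((\<lambda>s. m - s *\<^sub>R ?g) \<longlongrightarrow> m - 0 *\<^sub>R ?g) (at_right 0)"
      by (intro tendsto_intros)
    then have "\<forall>\<^sub>F s in at_right 0. m - s *\<^sub>R ?g \<in> ball \<xi> r"
      using mr by (intro topological_tendstoD) (auto simp: dist_commute)
    moreover have "\<forall>\<^sub>F s in at_right 0. (0::real) < s"
      by (simp add: eventually_at_right_less)
    ultimately have ev: "\<forall>\<^sub>F s in at_right 0. u m + q \<bullet> w - k * s * (norm ?g)\<^sup>2 \<le> u z"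
    proof eventually_elim
      case (elim s)
      have st: "hstep m (-(s *\<^sub>R w)) = m - s *\<^sub>R ?g"
        using hstep_scaleR[of m "-s" w] zw by simp
      have in1: "m - s *\<^sub>R ?g \<in> cball \<xi> r" using elim by auto
      have n1: "(1 + s) * u m \<le> u (m - s *\<^sub>R ?g) + s * u z"
        using H_convex_fun_two_sided[OF u, of m s w] elim z in1 rsub closure_subset zw st
        by (metis subsetD)
      have n2: "u (m - s *\<^sub>R ?g) \<le> u m + k * ((norm (d - s *\<^sub>R ?g))\<^sup>2 - (norm d)\<^sup>2)"
        using mmax[OF in1] by (simp add: d_def algebra_simps)
      have n3: "(norm (d - s *\<^sub>R ?g))\<^sup>2 - (norm d)\<^sup>2 = s * (s * (norm ?g)\<^sup>2 - 2 * (d \<bullet> ?g))"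
        unfolding power2_norm_eq_inner
        by (simp add: inner_diff_left inner_diff_right inner_commute algebra_simps)
      have "(1 + s) * u m \<le> u m + k * (s * (s * (norm ?g)\<^sup>2 - 2 * (d \<bullet> ?g))) + s * u z"
        using n1 n2 unfolding n3 by linarith
      moreover have "s * (u m + q \<bullet> w - k * s * (norm ?g)\<^sup>2) =
          (1 + s) * u m - u m - k * (s * (s * (norm ?g)\<^sup>2 - 2 * (d \<bullet> ?g)))"
        unfolding q zw by (simp only: ring_distribs) simp
      ultimately have "s * (u m + q \<bullet> w - k * s * (norm ?g)\<^sup>2) \<le> s * u z"
        by linarith
      then show ?case using elim by simp
    qed
    have "((\<lambda>s. u m + q \<bullet> w - k * s * (norm ?g)\<^sup>2) \<longlongrightarrow> u m + q \<bullet> w - k * 0 * (norm ?g)\<^sup>2)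
        (at_right 0)"
      by (intro tendsto_intros)
    from tendsto_upperbound[OF this ev] show "u m + q \<bullet> (Pr1 z - Pr1 m) \<le> u z"
      by (simp add: w_def)
  qed
  moreover have "m \<in> \<Omega>" using m rsub by auto
  ultimately show ?thesis using that[of m] mr r(2) by auto
qed

section \<open>Approximate selections and variational inequalities\<close>

text \<open>Arbitrary choices from \<open>Q\<close> at a finite net of mesh \<open>e\<close> are
  averaged with a partition of unity made of tent functions; at \<open>v\<close> only net points
  within \<open>e\<close> of \<open>v\<close> have positive weight. No regularity of
  \<open>Q\<close> enters.\<close>

lemma approximate_continuous_selection:
  fixes Q :: "'a::metric_space \<Rightarrow> 'b::real_normed_vector set"
  assumes "compact K" "0 < e" and ne: "\<And>v. v \<in> K \<Longrightarrow> Q v \<noteq> {}"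
  obtains f where "continuous_on K f"
    "\<And>v. v \<in> K \<Longrightarrow> f v \<in> convex hull (\<Union>w\<in>K \<inter> ball v e. Q w)"
proof -
  define q where "q v = (SOME x. x \<in> Q v)" for v
  have q: "q v \<in> Q v" if "v \<in> K" for v
    using ne[OF that] unfolding q_def by (simp add: some_in_eq)
  obtain T where T: "T \<subseteq> K" "finite T" "K \<subseteq> (\<Union>w\<in>T. ball w e)"
    using compactE_image[OF assms(1), of K "\<lambda>w. ball w e"] \<open>0 < e\<close>
    by (metis UN_I centre_in_ball open_ball subsetI)
  define \<phi> where "\<phi> = (\<lambda>(w::'a) v. max (0::real) (e - dist w v))"
  have \<phi>0: "\<phi> w v \<ge> 0" for w v unfolding \<phi>_def by simp
  define S where "S = (\<lambda>v. \<Sum>w\<in>T. \<phi> w v)"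
  have Spos: "S v > 0" if v: "v \<in> K" for v
  proof -
    obtain w where "w \<in> T" "v \<in> ball w e" using T(3) v by blast
    then show ?thesis unfolding S_def using T(2) \<phi>0
      by (intro sum_pos2[of T w]) (auto simp: \<phi>_def)
  qed
  define f where "f = (\<lambda>v. \<Sum>w\<in>T. (\<phi> w v / S v) *\<^sub>R q w)"
  have "continuous_on K f"
    unfolding f_def
  proof (intro continuous_intros ballI)
    show "S v \<noteq> 0" if "v \<in> K" for v using Spos[OF that] by simp
  qed (auto simp: \<phi>_def S_def intro!: continuous_intros)
  moreover have "f v \<in> convex hull (\<Union>w\<in>K \<inter> ball v e. Q w)" if v: "v \<in> K" for v
  proof -
    let ?T = "{w\<in>T. dist w v < e}"
    have z: "\<phi> w v = 0" if "w \<in> T - ?T" for w using that by (auto simp: \<phi>_def)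
    have "f v = (\<Sum>w\<in>?T. (\<phi> w v / S v) *\<^sub>R q w)"
      unfolding f_def using T(2) z by (intro sum.mono_neutral_right) auto
    also have "\<dots> \<in> convex hull (\<Union>w\<in>K \<inter> ball v e. Q w)"
    proof (rule convex_sum)
      have "(\<Sum>w\<in>?T. \<phi> w v / S v) = (\<Sum>w\<in>T. \<phi> w v / S v)"
        using T(2) z by (intro sum.mono_neutral_left) auto
      also have "\<dots> = S v / S v"
        by (simp only: S_def sum_divide_distrib)
      finally show "(\<Sum>w\<in>?T. \<phi> w v / S v) = 1" using Spos[OF v] by simp
      show "q w \<in> convex hull (\<Union>w\<in>K \<inter> ball v e. Q w)" if "w \<in> ?T" for w
        using that T(1) q by (intro hull_inc UN_I[of w]) (auto simp: dist_commute)
    qed (use T(2) \<phi>0 Spos[OF v] in auto)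
    finally show ?thesis .
  qed
  ultimately show ?thesis using that by blast
qed

text \<open>Brouwer's theorem is applied to v \<mapsto> proj_K(v - f v). At a fixed point, the
  obtuse-angle property of the projection is exactly the claimed inequality.\<close>

lemma variational_inequality:
  fixes f :: "'a::euclidean_space \<Rightarrow> 'a"
  assumes K: "compact K" "convex K" "K \<noteq> {}" and f: "continuous_on K f"
  obtains v where "v \<in> K" "\<And>y. y \<in> K \<Longrightarrow> 0 \<le> f v \<bullet> (y - v)"
proof -
  have cl: "closed K" using K(1) compact_imp_closed by blast
  let ?g = "\<lambda>v. closest_point K (v - f v)"
  have "continuous_on K ?g"
    by (intro continuous_on_compose2[OF continuous_on_closest_point[OF K(2) cl K(3), of UNIV]]
        continuous_on_diff continuous_on_id f subset_UNIV)
  moreover have "?g \<in> K \<rightarrow> K" using closest_point_in_set[OF cl K(3)] by simp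
  ultimately obtain v where v: "v \<in> K" "?g v = v" by (rule brouwer[OF K])
  have "0 \<le> f v \<bullet> (y - v)" if "y \<in> K" for y
    using closest_point_dot[OF K(2) cl that, of "v - f v"] v(2) by simp
  with v(1) show ?thesis using that by blast
qed


text \<open>Solutions for the approximate selections accumulate at \<open>v\<close> by compactness
  of \<open>K\<close>, and the subgradient inequalities pass to the limit through continuity of
  \<open>u\<close>. The target point must lie in the open set \<Omega> so that the steps from nearby
  base points also end in \<Omega>.\<close>

lemma H_subdiff_variational_limit:
  fixes \<Omega> :: "'n::finite hpt set"
  assumes "open \<Omega>" and cont: "continuous_on (closure \<Omega>) u" and u: "H_convex_fun (closure \<Omega>) u"
    and K: "compact K" "convex K" "K \<noteq> {}"
    and L: "continuous_on K L" "L ` K \<subseteq> closure \<Omega>"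
  obtains v where "v \<in> K"
    "\<And>y. \<lbrakk>y \<in> K; hstep (L v) (y - v) \<in> \<Omega>\<rbrakk> \<Longrightarrow> p \<bullet> (y - v) \<le> u (hstep (L v) (y - v)) - u (L v)"
proof -
  \<comment> \<open>Density supplies subgradients only near \<open>L w\<close>, which may itself be
    a boundary point.\<close>
  define Q where "Q = (\<lambda>e w. \<Union>m\<in>\<Omega> \<inter> ball (L w) e. H_subdiff \<Omega> u m)"
  have ne: "Q e w \<noteq> {}" if w: "w \<in> K" and e: "0 < e" for e w
  proof -
    have "L w \<in> closure \<Omega>" using w L(2) by auto
    then obtain \<xi> where \<xi>: "\<xi> \<in> \<Omega>" "dist \<xi> (L w) < e / 2"
      using e closure_approachable[of "L w" \<Omega>] half_gt_zero by blast
    obtain m where m: "m \<in> \<Omega>" "dist m \<xi> < e / 2" "H_subdiff \<Omega> u m \<noteq> {}"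
      using H_subdiff_nonempty_dense[OF assms(1) continuous_on_subset[OF cont closure_subset] u \<xi>(1),
          of "e / 2"] e half_gt_zero by metis
    have "dist (L w) m < e"
      using dist_triangle[of "L w" m \<xi>] \<xi>(2) m(2) by (simp add: dist_commute)
    with m show ?thesis unfolding Q_def by (auto simp del: split_paired_Ex)
  qed
  have "\<exists>v\<in>K. \<exists>q \<in> convex hull (\<Union>w\<in>K \<inter> ball v e. Q e w). \<forall>y\<in>K. p \<bullet> (y - v) \<le> q \<bullet> (y - v)"
    if e: "0 < e" for e
  proof -
    obtain f where f: "continuous_on K f"
      "\<And>v. v \<in> K \<Longrightarrow> f v \<in> convex hull (\<Union>w\<in>K \<inter> ball v e. Q e w)"
      using approximate_continuous_selection[OF K(1) e, of "Q e"] ne[OF _ e] by metis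
    have "continuous_on K (\<lambda>v. f v - p)" by (intro continuous_intros f(1))
    then obtain v where "v \<in> K" "\<And>y. y \<in> K \<Longrightarrow> 0 \<le> (f v - p) \<bullet> (y - v)"
      using variational_inequality[OF K] by metis
    then show ?thesis using f(2)[of v]
      by (intro bexI[of _ v] bexI[of _ "f v"] ballI) (simp_all add: inner_diff_left)
  qed
  then have "\<forall>k::nat. \<exists>v\<in>K. \<exists>q \<in> convex hull (\<Union>w\<in>K \<inter> ball v (1 / Suc k). Q (1 / Suc k) w).
      \<forall>y\<in>K. p \<bullet> (y - v) \<le> q \<bullet> (y - v)"
    by simp
  then obtain V where V: "\<And>k::nat. V k \<in> K"
    "\<And>k. \<exists>q \<in> convex hull (\<Union>w\<in>K \<inter> ball (V k) (1 / Suc k). Q (1 / Suc k) w).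
      \<forall>y\<in>K. p \<bullet> (y - V k) \<le> q \<bullet> (y - V k)"
    by metis
  obtain l r where l: "l \<in> K" "strict_mono r" "(V \<circ> r) \<longlonglongrightarrow> l"
    using K(1) V(1) unfolding compact_def by metis
  have "p \<bullet> (y - l) \<le> u (hstep (L l) (y - l)) - u (L l)"
    if y: "y \<in> K" and z: "hstep (L l) (y - l) \<in> \<Omega>" for y
  proof (rule ccontr)
    assume neg: "\<not> p \<bullet> (y - l) \<le> u (hstep (L l) (y - l)) - u (L l)"
    let ?z = "hstep (L l) (y - l)"
    \<comment> \<open>A quarter of the supposed gap: the values of \<open>u\<close> at the end and
      at the start of the step and the term p \<bullet> v each cost less than \<eta>, leaving a
      strict inequality.\<close>
    define \<eta> where "\<eta> = (p \<bullet> (y - l) - (u ?z - u (L l))) / 4"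
    have \<eta>: "0 < \<eta>" using neg by (simp add: \<eta>_def)
    have \<eta>4: "4 * \<eta> = p \<bullet> y - p \<bullet> l - u ?z + u (L l)" by (simp add: \<eta>_def inner_diff_right)
    have Ll: "L l \<in> closure \<Omega>" using l(1) L(2) by auto
    obtain d1 where d1: "0 < d1" "\<And>m. m \<in> closure \<Omega> \<Longrightarrow> dist m (L l) \<le> d1 \<Longrightarrow> dist (u m) (u (L l)) < \<eta>"
      using continuous_onE[OF cont Ll \<eta>] by metis
    obtain d2 where d2: "0 < d2" "ball ?z d2 \<subseteq> \<Omega>"
      using assms(1) z open_contains_ball_eq by metis
    have zc: "?z \<in> closure \<Omega>" using z closure_subset by blast
    obtain d3 where d3: "0 < d3" "\<And>m. m \<in> closure \<Omega> \<Longrightarrow> dist m ?z \<le> d3 \<Longrightarrow> dist (u m) (u ?z) < \<eta>"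
      using continuous_onE[OF cont zc \<eta>] by metis
    have c4: "continuous_on UNIV (\<lambda>x. hstep (fst x) (y - snd x))"
      by (intro continuous_intros)
    have "0 < min d2 d3" using d2(1) d3(1) by simp
    from continuous_onE[OF c4 UNIV_I this, of "(L l, l)"] obtain d4 where d4: "0 < d4"
      "\<And>x. dist x (L l, l) \<le> d4 \<Longrightarrow> dist (hstep (fst x) (y - snd x)) ?z < min d2 d3"
      unfolding fst_conv snd_conv by (metis UNIV_I)
    have c5: "continuous_on UNIV (\<lambda>v. p \<bullet> v)" by (intro continuous_intros)
    obtain d5 where d5: "0 < d5" "\<And>v. dist v l \<le> d5 \<Longrightarrow> dist (p \<bullet> v) (p \<bullet> l) < \<eta>"
      using continuous_onE[OF c5 UNIV_I \<eta>, of l] by (metis UNIV_I)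
    define d where "d = min d1 (d4 / 2)"
    have d: "0 < d" "d \<le> d1" "d \<le> d4 / 2" using d1(1) d4(1) by (auto simp: d_def)
    obtain d6 where d6: "0 < d6" "\<And>w. w \<in> K \<Longrightarrow> dist w l \<le> d6 \<Longrightarrow> dist (L w) (L l) < d / 2"
      using continuous_onE[OF L(1) l(1) half_gt_zero[OF d(1)]] by metis
    \<comment> \<open>A contributing net point \<open>w\<close> is within 2e of \<open>l\<close>,
      whence \<open>d6 / 2\<close>; its subgradient sits at a point within e of \<open>L w\<close>,
      hence within d of \<open>L l\<close>, whence \<open>d / 2\<close>.\<close>
    define e where "e = min (min d5 (d / 2)) (d6 / 2)"
    have e: "0 < e" "e \<le> d5" "e \<le> d / 2" "e \<le> d6 / 2"
      using d d5(1) d6(1) by (auto simp: e_def)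
    have "(\<lambda>k. 1 / real (Suc k)) \<longlonglongrightarrow> 0"
      using LIMSEQ_inverse_real_of_nat by (simp add: inverse_eq_divide)
    then have "((\<lambda>k. 1 / real (Suc k)) \<circ> r) \<longlonglongrightarrow> 0"
      using l(2) LIMSEQ_subseq_LIMSEQ by blast
    then have "\<forall>\<^sub>F k in sequentially. 1 / real (Suc (r k)) < e"
      using order_tendstoD(2)[OF _ e(1)] by (simp add: o_def)
    moreover have "\<forall>\<^sub>F k in sequentially. dist ((V \<circ> r) k) l < e"
      by (rule tendstoD[OF l(3) e(1)])
    ultimately have "\<forall>\<^sub>F k in sequentially. 1 / real (Suc (r k)) < e \<and> dist ((V \<circ> r) k) l < e"
      by (rule eventually_conj)
    then obtain k where k: "1 / real (Suc (r k)) < e" "dist (V (r k)) l < e"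
      unfolding eventually_sequentially by auto
    define v where "v = V (r k)"
    define t where "t = 1 / real (Suc (r k))"
    have vl: "dist v l < e" and te: "t < e" using k by (auto simp: v_def t_def)
    obtain q where q: "q \<in> convex hull (\<Union>w\<in>K \<inter> ball v t. Q t w)" "p \<bullet> (y - v) \<le> q \<bullet> (y - v)"
      using V(2)[of "r k"] y unfolding v_def t_def by blast
    \<comment> \<open>Every contributing subgradient lies in one open half-space. A half-space is
      convex, so it contains the convex hull too, contradicting the choice of
      \<open>q\<close>.\<close>
    have "(\<Union>w\<in>K \<inter> ball v t. Q t w) \<subseteq> {q. (y - v) \<bullet> q < p \<bullet> (y - v)}"
    proof (clarsimp simp: Q_def simp del: split_paired_All split_paired_Ex)
      fix w m q'
      assume w: "w \<in> K" "dist v w < t" and m: "m \<in> \<Omega>" "dist (L w) m < t"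
        and q': "q' \<in> H_subdiff \<Omega> u m"
      have "dist w l \<le> d6"
        using dist_triangle[of w l v] w(2) vl te e(4) by (simp add: dist_commute)
      from d6(2)[OF w(1) this] have mL: "dist m (L l) < d"
        using dist_triangle[of m "L l" "L w"] m(2) te e(3) by (simp add: dist_commute)
      have "dist (m, v) (L l, l) \<le> dist m (L l) + dist v l"
        using sqrt_sum_squares_le_sum_abs[of "dist m (L l)" "dist v l"] by (simp add: dist_Pair_Pair)
      also have "\<dots> < d4" using mL vl d e(3) by linarith
      finally have z': "dist (hstep m (y - v)) ?z < min d2 d3" using d4(2)[of "(m, v)"] by simp
      then have z'\<Omega>: "hstep m (y - v) \<in> \<Omega>" using d2(2) by (auto simp: dist_commute)
      have "dist (u (hstep m (y - v))) (u ?z) < \<eta>"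
        using d3(2)[of "hstep m (y - v)"] z' z'\<Omega> closure_subset[of \<Omega>] by auto
      moreover have "dist (u m) (u (L l)) < \<eta>"
        using d1(2)[of m] m(1) closure_subset[of \<Omega>] mL d(2) by auto
      moreover have "dist (p \<bullet> v) (p \<bullet> l) < \<eta>" using d5(2) vl e(2) by simp
      ultimately have "u (hstep m (y - v)) - u m < p \<bullet> (y - v)"
        using \<eta> \<eta>4 unfolding dist_real_def abs_less_iff inner_diff_right by linarith
      moreover have "u m + q' \<bullet> (y - v) \<le> u (hstep m (y - v))"
        using q' z'\<Omega> hstep_in_hplane[of m "y - v"] unfolding H_subdiff_def by force
      ultimately show "(y - v) \<bullet> q' < p \<bullet> (y - v)" by (simp add: inner_commute)
    qed
    from hull_minimal[where S = convex, OF this convex_halfspace_lt] q show False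
      by (auto simp: inner_commute)
  qed
  with l(1) show ?thesis using that by blast
qed

section \<open>The slice of the domain by a horizontal plane\<close>

definition hlift :: "'n::finite hpt \<Rightarrow> (real^'n) \<times> (real^'n) \<Rightarrow> 'n hpt" where
  "hlift p v = hstep p (v - Pr1 p)"

text \<open>As a preimage under a continuous affine map, the slice inherits openness and convexity
  from \<Omega>.\<close>

definition hslice :: "'n::finite hpt set \<Rightarrow> 'n hpt \<Rightarrow> ((real^'n) \<times> (real^'n)) set" where
  "hslice \<Omega> p = hlift p -` \<Omega>"

lemma Pr1_hlift [simp]: "Pr1 (hlift p v) = v"
  by (simp add: hlift_def)

lemma hlift_Pr1: "z \<in> hplane p \<Longrightarrow> hlift p (Pr1 z) = z"
  using hplane_iff_hstep hlift_def by metis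

lemma hlift_in_hplane: "hlift p v \<in> hplane p"
  by (simp add: hlift_def hstep_in_hplane)

lemma hlift_self [simp]: "hlift p (Pr1 p) = p"
  by (simp add: hlift_def)

lemma hlift_convex_comb:
  "a + b = 1 \<Longrightarrow> hlift p (a *\<^sub>R v + b *\<^sub>R w) = a *\<^sub>R hlift p v + b *\<^sub>R hlift p w"
proof -
  assume "a + b = 1"
  then have "b = 1 - a" by simp
  show ?thesis unfolding \<open>b = 1 - a\<close>
    by (cases p; cases v; cases w) (simp add: hlift_def hstep_def Pr1_def algebra_simps)
qed

lemma continuous_on_hlift: "continuous_on S (hlift p)"
  unfolding hlift_def by (intro continuous_intros)

lemma hstep_hlift_back: "hstep (hlift p v) (Pr1 p - v) = p"
  using hstep_hstep_collinear[of p 1 "v - Pr1 p" "-1"] by (simp add: hlift_def)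

lemma open_hslice: "open \<Omega> \<Longrightarrow> open (hslice \<Omega> p)"
  unfolding hslice_def by (rule open_vimage[OF _ continuous_on_hlift])

lemma convex_hslice:
  assumes "convex \<Omega>"
  shows "convex (hslice \<Omega> p)"
  unfolding convex_def hslice_def
  by (auto simp: hlift_convex_comb intro: convexD[OF assms])

lemma hlift_closure_hslice: "v \<in> closure (hslice \<Omega> p) \<Longrightarrow> hlift p v \<in> closure \<Omega>"
proof -
  have "hlift p ` closure (hslice \<Omega> p) \<subseteq> closure \<Omega>"
    by (rule image_closure_subset[OF continuous_on_hlift closed_closure])
       (use closure_subset in \<open>auto simp: hslice_def simp del: split_paired_All\<close>)
  then show "v \<in> closure (hslice \<Omega> p) \<Longrightarrow> hlift p v \<in> closure \<Omega>" by blast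
qed

lemma frontier_open_iff: "open S \<Longrightarrow> x \<in> frontier S \<longleftrightarrow> x \<in> closure S \<and> x \<notin> S"
  by (simp add: frontier_def interior_open)

lemma hlift_frontier_hslice:
  "open \<Omega> \<Longrightarrow> v \<in> frontier (hslice \<Omega> p) \<Longrightarrow> hlift p v \<in> frontier \<Omega>"
  using hlift_closure_hslice[of v \<Omega> p] open_hslice[of \<Omega> p]
  by (simp add: frontier_open_iff) (simp add: hslice_def)

section \<open>Sign of u, and subgradients from affine functions on the slice\<close>

lemma H_convex_nonpos:
  fixes \<Omega> :: "'n::finite hpt set"
  assumes "open \<Omega>" "H_convex_fun (closure \<Omega>) u" "p0 \<in> \<Omega>" "bounded (hslice \<Omega> p0)"
    and zero: "\<And>p. p \<in> frontier \<Omega> \<Longrightarrow> u p = 0"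
  shows "u p0 \<le> 0"
proof -
  obtain w :: "(real^'n) \<times> (real^'n)" where w: "w \<noteq> 0"
    using nonempty_Basis nonzero_Basis by (metis all_not_in_conv)
  have "Pr1 p0 \<in> hslice \<Omega> p0" using assms(3) by (simp add: hslice_def)
  then have int: "Pr1 p0 \<in> interior (hslice \<Omega> p0)"
    using open_hslice[OF assms(1)] by (simp add: interior_open)
  \<comment> \<open>The slice is bounded, so the horizontal line through \<open>p0\<close> leaves it
    on both sides, at points over the frontier of \<Omega>, where \<open>u\<close> vanishes.
    Convexity with displacement a w and ratio b/a then gives the sign at \<open>p0\<close>.\<close>
  obtain a where a: "0 < a" "Pr1 p0 + a *\<^sub>R w \<in> frontier (hslice \<Omega> p0)"
    using ray_to_frontier[OF assms(4) int w] by metis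
  obtain b where b: "0 < b" "Pr1 p0 + b *\<^sub>R (- w) \<in> frontier (hslice \<Omega> p0)"
    using ray_to_frontier[OF assms(4) int, of "- w"] w by (metis neg_equal_0_iff_equal)
  have a': "hstep p0 (a *\<^sub>R w) \<in> frontier \<Omega>"
    using hlift_frontier_hslice[OF assms(1) a(2)] by (simp add: hlift_def)
  have b': "hstep p0 (-((b / a) *\<^sub>R (a *\<^sub>R w))) \<in> frontier \<Omega>"
    using hlift_frontier_hslice[OF assms(1) b(2)] a(1) by (simp add: hlift_def)
  have "(1 + b / a) * u p0 \<le> u (hstep p0 (-((b / a) *\<^sub>R (a *\<^sub>R w)))) + b / a * u (hstep p0 (a *\<^sub>R w))"
    using a' b' a(1) b(1)
    by (intro H_convex_fun_two_sided[OF assms(2)]) (simp_all add: frontier_def)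
  also have "\<dots> = 0" using zero[OF a'] zero[OF b'] by simp
  finally have "(1 + b / a) * u p0 \<le> 0" .
  moreover have "0 < 1 + b / a" using a(1) b(1) by (simp add: add_pos_pos)
  ultimately show ?thesis by (simp add: mult_le_0_iff)
qed

lemma H_subdiff_polar:
  fixes \<Omega> :: "'n::finite hpt set"
  assumes "open \<Omega>" "convex \<Omega>" "continuous_on (closure \<Omega>) u" and u: "H_convex_fun (closure \<Omega>) u"
    and "p0 \<in> \<Omega>" "bounded (hslice \<Omega> p0)"
    and zero: "\<And>p. p \<in> frontier \<Omega> \<Longrightarrow> u p = 0"
    and p: "\<And>v. v \<in> closure (hslice \<Omega> p0) \<Longrightarrow> p \<bullet> (v - Pr1 p0) < - u p0"
  shows "p \<in> H_subdiff_set \<Omega> u (\<Omega> \<inter> hplane p0)"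
proof -
  let ?K = "closure (hslice \<Omega> p0)"
  have c: "Pr1 p0 \<in> ?K" using assms(5) closure_subset[of "hslice \<Omega> p0"] by (auto simp: hslice_def)
  have "compact ?K" "convex ?K" "?K \<noteq> {}"
    using assms(6) c convex_closure[OF convex_hslice[OF assms(2)]]
    by (auto simp: compact_eq_bounded_closed simp del: split_paired_Ex)
  then obtain v where v: "v \<in> ?K" and vi: "\<And>y. y \<in> ?K \<Longrightarrow> hstep (hlift p0 v) (y - v) \<in> \<Omega> \<Longrightarrow>
      p \<bullet> (y - v) \<le> u (hstep (hlift p0 v) (y - v)) - u (hlift p0 v)"
    using H_subdiff_variational_limit[OF assms(1,3) u _ _ _ continuous_on_hlift, of ?K p0 p]
      hlift_closure_hslice image_subsetI[of ?K "hlift p0" "closure \<Omega>"] by metis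
  \<comment> \<open>The step back from \<open>hlift p0 v\<close> ends at \<open>p0\<close> itself.
    If \<open>u\<close> vanished at \<open>hlift p0 v\<close>, this would give p \<bullet> (v - Pr1
    p0) \<ge> -u(p0), against the hypothesis; so the point is not on the frontier.\<close>
  have "p \<bullet> (Pr1 p0 - v) \<le> u p0 - u (hlift p0 v)"
    using vi[OF c] assms(5) by (simp add: hstep_hlift_back)
  then have "u (hlift p0 v) \<noteq> 0"
    using p[OF v] by (auto simp: inner_diff_right)
  then have v\<Omega>: "hlift p0 v \<in> \<Omega>"
    using zero hlift_closure_hslice[OF v] frontier_open_iff[OF assms(1)] by metis
  have "p \<in> H_subdiff \<Omega> u (hlift p0 v)"
    unfolding H_subdiff_def
  proof (intro CollectI ballI)
    fix z assume z: "z \<in> \<Omega> \<inter> hplane (hlift p0 v)"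
    define w where "w = Pr1 z - v"
    have zw: "hstep (hlift p0 v) w = z"
      using z hplane_iff_hstep[of z "hlift p0 v"] by (simp add: w_def)
    have "v \<in> hslice \<Omega> p0" using v\<Omega> by (simp add: hslice_def)
    then obtain e where e: "0 < e" "ball v e \<subseteq> hslice \<Omega> p0"
      using open_hslice[OF assms(1)] open_contains_ball_eq by metis
    \<comment> \<open>The variational inequality can only be tested over the slice, and
      \<open>Pr1 z\<close> may lie outside it. The factor \<open>l\<close> shortens the step into
      the ball around \<open>v\<close> (the +1 covers w = 0); convexity along the segment then
      carries the inequality out to \<open>z\<close>.\<close>
    define l where "l = min 1 (e / (2 * (norm w + 1)))"
    have l: "0 < l" "l \<le> 1" using e(1) by (auto simp: l_def add_nonneg_pos)
    have "l * norm w \<le> e / (2 * (norm w + 1)) * norm w"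
      by (intro mult_right_mono) (auto simp: l_def)
    also have "\<dots> < e"
      using e(1) by (simp add: divide_simps add_nonneg_pos)
    finally have "v + l *\<^sub>R w \<in> ball v e" using l(1) by (simp add: dist_norm)
    then have inK: "v + l *\<^sub>R w \<in> ?K" using e(2) closure_subset by blast
    have "hstep (hlift p0 v) (l *\<^sub>R w) = (1 - l) *\<^sub>R hlift p0 v + l *\<^sub>R z"
      by (simp add: hstep_scaleR zw algebra_simps)
    also have "\<dots> \<in> \<Omega>"
      using convexD[OF assms(2) v\<Omega>, of z "1 - l" l] z l by simp
    finally have "p \<bullet> (l *\<^sub>R w) \<le> u (hstep (hlift p0 v) (l *\<^sub>R w)) - u (hlift p0 v)"
      using vi[OF inK] by simp
    also have "u (hstep (hlift p0 v) (l *\<^sub>R w)) \<le> (1 - l) * u (hlift p0 v) + l * u z"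
      using H_convex_fun_hstep[OF u, of "hlift p0 v" w l] v\<Omega> z zw l closure_subset by auto
    finally have "l * (p \<bullet> w) \<le> l * (u z - u (hlift p0 v))" by (simp add: algebra_simps)
    then have "p \<bullet> w \<le> u z - u (hlift p0 v)" using l(1) by simp
    then show "u (hlift p0 v) + p \<bullet> (Pr1 z - Pr1 (hlift p0 v)) \<le> u z"
      by (simp add: w_def)
  qed
  then show ?thesis
    unfolding H_subdiff_set_def using v\<Omega> hlift_in_hplane by blast
qed

section \<open>Volume of a tube\<close>

text \<open>Disjoint balls of radius \<open>r\<close> are packed with centres 2r apart along the
  axis. The bound is stated for measurable supersets \<open>B\<close>, the sets over which the outer
  measure is an infimum.\<close>

lemma emeasure_tube_ge:
  fixes e :: "'a::euclidean_space"
  assumes "norm e = 1" "0 < r" "0 \<le> h"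
    and B: "B \<in> sets lebesgue" "(\<Union>\<alpha>\<in>{0..h}. ball (\<alpha> *\<^sub>R e) r) \<subseteq> B"
  shows "ennreal (h / (2 * r) * (unit_ball_vol (DIM('a)) * r ^ DIM('a))) \<le> emeasure lebesgue B"
proof -
  let ?V = "unit_ball_vol (DIM('a)) * r ^ DIM('a)"
  have V: "0 \<le> ?V" using assms(2) by simp
  \<comment> \<open>The centres have indices 0 to n, so there are n + 1 balls, at least h/(2r); the
    last centre 2rn is still at most h.\<close>
  define n where "n = nat \<lfloor>h / (2 * r)\<rfloor>"
  have n: "real n \<le> h / (2 * r)" "h / (2 * r) \<le> real (Suc n)"
    using assms(2,3) unfolding n_def by (auto simp: of_nat_nat) linarith+
  define A where "A = (\<lambda>k::nat. ball ((2 * r * real k) *\<^sub>R e) r)"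
  have disj: "disjoint_family_on A {..n}"
    unfolding disjoint_family_on_def
  proof (intro ballI impI)
    fix i j :: nat assume "i \<noteq> j"
    have "dist ((2 * r * real i) *\<^sub>R e) ((2 * r * real j) *\<^sub>R e) = 2 * r * \<bar>real i - real j\<bar>"
      using assms(1,2)
      by (simp add: dist_norm flip: scaleR_diff_left right_diff_distrib) (simp add: abs_mult)
    moreover have "1 \<le> \<bar>real i - real j\<bar>" using \<open>i \<noteq> j\<close> by linarith
    ultimately have "2 * r \<le> dist ((2 * r * real i) *\<^sub>R e) ((2 * r * real j) *\<^sub>R e)"
      using assms(2) by simp
    then show "A i \<inter> A j = {}"
      unfolding A_def by (intro disjoint_ballI) simp
  qed
  have sub: "(\<Union>k\<le>n. A k) \<subseteq> B"
  proof -
    have "2 * r * real k \<in> {0..h}" if "k \<le> n" for k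
    proof -
      have "real k \<le> h / (2 * r)" using that n(1) by linarith
      then show ?thesis using assms(2) by (simp add: field_simps)
    qed
    then show ?thesis using B(2) unfolding A_def by blast
  qed
  have "ennreal (h / (2 * r) * ?V) \<le> ennreal (real (Suc n) * ?V)"
    using n(2) V by (intro ennreal_leI mult_right_mono) auto
  also have "\<dots> = (\<Sum>k\<le>n. ennreal ?V)"
    using V by (simp add: ennreal_mult ennreal_of_nat_eq_real_of_nat del: of_nat_Suc)
  also have "\<dots> = (\<Sum>k\<le>n. emeasure lebesgue (A k))"
    unfolding A_def using assms(2) by (simp add: emeasure_ball)
  also have "\<dots> = emeasure lebesgue (\<Union>k\<le>n. A k)"
    using disj by (intro sum_emeasure) (auto simp: A_def)
  also have "\<dots> \<le> emeasure lebesgue B"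
    by (rule emeasure_mono[OF sub B(1)])
  finally show ?thesis .
qed


section \<open>The estimate\<close>

text \<open>Horizontal boundedness makes the set of distances bounded above, so that the real
  supremum in \<open>diamH\<close> really is an upper bound.\<close>

lemma le_diamH:
  assumes "horiz_bounded \<Omega>" "p \<in> \<Omega>" "q \<in> \<Omega> \<inter> hplane p"
  shows "norm (Pr1 q - Pr1 p) \<le> diamH (\<Omega> \<inter> hplane p)"
proof -
  let ?A = "\<Omega> \<inter> hplane p"
  have p: "p \<in> ?A" using assms(2) hstep_in_hplane[of p 0] by simp
  obtain M where "\<forall>a\<in>?A. \<forall>b\<in>?A. dH a b \<le> M"
    using assms(1,2) unfolding horiz_bounded_def by blast
  then have "bdd_above ((\<lambda>pq. dH (fst pq) (snd pq)) ` (?A \<times> ?A))"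
    by (intro bdd_aboveI2[of _ _ M]) (simp add: mem_Times_iff del: Int_iff)
  from cSUP_upper[OF _ this, of "(q, p)"] have "dH q p \<le> diamH ?A"
    using p assms(3) unfolding diamH_def by simp
  then show ?thesis using dH_hplane(2) assms(3) by (metis IntD2)
qed

lemma hslice_norm_le_diamH:
  assumes "horiz_bounded \<Omega>" "p \<in> \<Omega>" "v \<in> closure (hslice \<Omega> p)"
  shows "norm (v - Pr1 p) \<le> diamH (\<Omega> \<inter> hplane p)"
proof -
  have "hslice \<Omega> p \<subseteq> cball (Pr1 p) (diamH (\<Omega> \<inter> hplane p))"
  proof
    fix v assume "v \<in> hslice \<Omega> p"
    then have "hlift p v \<in> \<Omega> \<inter> hplane p" by (simp add: hslice_def hlift_in_hplane)
    from le_diamH[OF assms(1,2) this] show "v \<in> cball (Pr1 p) (diamH (\<Omega> \<inter> hplane p))"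
      by (simp add: dist_norm norm_minus_commute)
  qed
  then have "closure (hslice \<Omega> p) \<subseteq> cball (Pr1 p) (diamH (\<Omega> \<inter> hplane p))"
    by (rule closure_minimal) simp
  then show ?thesis using assms(3) by (auto simp: dist_norm norm_minus_commute)
qed

text \<open>Take a nearest point x of the frontier in the plane, at distance d from the centre, and
  let \<open>e\<close> be the unit normal of a hyperplane separating x from the convex slice. On the
  slice e \<bullet> (v - c) is at most e \<bullet> (x - c), hence at most d by
  Cauchy-Schwarz.\<close>

lemma hslice_supporting_functional:
  fixes \<Omega> :: "'n::finite hpt set"
  assumes "open \<Omega>" "convex \<Omega>" "p0 \<in> \<Omega>" "bounded (hslice \<Omega> p0)"
  obtains e d where "norm e = 1" "0 < d" "d \<le> distH p0 (frontier \<Omega> \<inter> hplane p0)"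
    "\<And>v. v \<in> closure (hslice \<Omega> p0) \<Longrightarrow> e \<bullet> (v - Pr1 p0) \<le> d"
proof -
  let ?D = "hslice \<Omega> p0" and ?c = "Pr1 p0"
  \<comment> \<open>This is the projection of the very set over which \<open>distH\<close> takes its
    infimum. A nonempty bounded slice has a frontier, so \<open>?S\<close> is nonempty.\<close>
  let ?S = "hlift p0 -` frontier \<Omega>"
  have c: "?c \<in> ?D" using assms(3) by (simp add: hslice_def)
  have "frontier ?D \<noteq> {}"
    using c assms(4) by (intro frontier_not_empty) auto
  then obtain x0 where "x0 \<in> frontier ?D" by blast
  then have "?S \<noteq> {}" using hlift_frontier_hslice[OF assms(1)] by blast
  moreover have "closed ?S" by (rule closed_vimage[OF frontier_closed continuous_on_hlift])
  ultimately obtain x where x: "x \<in> ?S" "\<And>y. y \<in> ?S \<Longrightarrow> dist ?c x \<le> dist ?c y"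
    using distance_attains_inf by metis
  have xD: "x \<notin> ?D" using x(1) by (simp add: hslice_def frontier_open_iff[OF assms(1)])
  define d where "d = dist ?c x"
  have "d \<le> distH p0 (frontier \<Omega> \<inter> hplane p0)"
    unfolding distH_def
  proof (rule cINF_greatest)
    show "frontier \<Omega> \<inter> hplane p0 \<noteq> {}" using x(1) hlift_in_hplane by blast
    fix q assume q: "q \<in> frontier \<Omega> \<inter> hplane p0"
    then have "Pr1 q \<in> ?S" using hlift_Pr1 by (metis IntD1 IntD2 vimageI)
    from x(2)[OF this] show "d \<le> dH p0 q"
      using q dH_hplane(1)[of q p0] by (simp add: d_def dist_norm norm_minus_commute)
  qed
  moreover have "0 < d" using c xD unfolding d_def by auto
  moreover obtain a b where ab: "a \<noteq> 0" "\<And>y. y \<in> ?D \<Longrightarrow> a \<bullet> y \<le> b" "b \<le> a \<bullet> x"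
    using separating_hyperplane_sets[OF convex_hslice[OF assms(2)] convex_singleton, of p0 x] c xD
    by (metis Int_insert_right_if0 Int_empty_right empty_iff insert_not_empty singletonI)
  define e where "e = a /\<^sub>R norm a"
  have "norm e = 1" using ab(1) by (simp add: e_def)
  moreover have "e \<bullet> (v - ?c) \<le> d" if "v \<in> closure ?D" for v
  proof -
    have "?D \<subseteq> {y. a \<bullet> y \<le> b}" using ab(2) by blast
    then have "closure ?D \<subseteq> {y. a \<bullet> y \<le> b}"
      by (rule closure_minimal) (rule closed_halfspace_le)
    then have "a \<bullet> (v - ?c) \<le> a \<bullet> (x - ?c)"
      using that ab(3) by (auto simp: inner_diff_right)
    then have "e \<bullet> (v - ?c) \<le> e \<bullet> (x - ?c)"
      by (simp add: e_def divide_right_mono mult_left_mono)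
    also have "\<dots> \<le> norm e * norm (x - ?c)" by (rule norm_cauchy_schwarz)
    also have "\<dots> = d" using \<open>norm e = 1\<close> by (simp add: d_def dist_norm norm_minus_commute)
    finally show ?thesis .
  qed
  ultimately show ?thesis using that by blast
qed

lemma bounded_hslice:
  assumes "horiz_bounded \<Omega>" "p \<in> \<Omega>"
  shows "bounded (hslice \<Omega> p)"
proof (rule bounded_subset[OF bounded_cball])
  show "hslice \<Omega> p \<subseteq> cball (Pr1 p) (diamH (\<Omega> \<inter> hplane p))"
    using hslice_norm_le_diamH[OF assms] closure_subset[of "hslice \<Omega> p"]
    by (auto simp: dist_norm norm_minus_commute)
qed

lemma lebesgue_outer_ge:
  assumes "\<And>B. B \<in> sets lebesgue \<Longrightarrow> A \<subseteq> B \<Longrightarrow> m \<le> emeasure lebesgue B"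
  shows "m \<le> lebesgue_outer A"
  unfolding lebesgue_outer_def using assms by (intro INF_greatest) blast

theorem theorem4p1:
  "\<exists>C>0. \<forall>(\<Omega>::('n::finite) hpt set) u. open \<Omega> \<and> horiz_bounded \<Omega> \<and> convex \<Omega> \<and>
      continuous_on (closure \<Omega>) u \<and> H_convex_fun (closure \<Omega>) u \<and> (\<forall>p\<in>frontier \<Omega>. u p = 0) \<longrightarrow>
      (\<forall>p0\<in>\<Omega>. ennreal (\<bar>u p0\<bar> ^ (2 * CARD('n))) \<le>
         ennreal (C * distH p0 (frontier \<Omega> \<inter> hplane p0) * diamH (\<Omega> \<inter> hplane p0) ^ (2 * CARD('n) - 1))
         * lebesgue_outer (H_subdiff_set \<Omega> u (\<Omega> \<inter> hplane p0)))"
proof -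
  let ?N = "2 * CARD('n)"
  have N: "DIM((real^'n) \<times> (real^'n)) = ?N" by simp
  have N0: "0 < ?N" by simp
  define \<beta> where "\<beta> = unit_ball_vol ?N"
  have \<beta>: "0 < \<beta>" by (simp add: \<beta>_def)
  \<comment> \<open>Chosen to make the final computation an equality: 2^N comes from the radius
    U/(2R), one more factor 2 from h/(2r) = R/(2d), and \<beta> from the volume of the
    balls.\<close>
  define C where "C = 2 ^ (?N + 1) / \<beta>"
  have C: "0 < C" using \<beta> by (simp add: C_def)
  have "ennreal (\<bar>u p0\<bar> ^ ?N) \<le>
      ennreal (C * distH p0 (frontier \<Omega> \<inter> hplane p0) * diamH (\<Omega> \<inter> hplane p0) ^ (?N - 1))
      * lebesgue_outer (H_subdiff_set \<Omega> u (\<Omega> \<inter> hplane p0))"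
    if \<Omega>: "open \<Omega>" "horiz_bounded \<Omega>" "convex \<Omega>" "continuous_on (closure \<Omega>) u"
      "H_convex_fun (closure \<Omega>) u" and zero: "\<forall>p\<in>frontier \<Omega>. u p = 0" and p0: "p0 \<in> \<Omega>"
    for \<Omega> :: "'n hpt set" and u p0
  proof (cases "u p0 = 0")
    case True
    then show ?thesis using N0 by (simp add: power_0_left)
  next
    case False
    let ?D = "hslice \<Omega> p0" and ?c = "Pr1 p0"
    define R where "R = diamH (\<Omega> \<inter> hplane p0)"
    have bD: "bounded ?D" using bounded_hslice[OF \<Omega>(2) p0] .
    define U where "U = - u p0"
    have U: "0 < U" "\<bar>u p0\<bar> = U"
      using H_convex_nonpos[OF \<Omega>(1,5) p0 bD] zero False by (auto simp: U_def simp del: split_paired_All)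
    obtain e d where e: "norm e = 1" and d: "0 < d" "d \<le> distH p0 (frontier \<Omega> \<inter> hplane p0)"
      and ed: "\<And>v. v \<in> closure ?D \<Longrightarrow> e \<bullet> (v - ?c) \<le> d"
      using hslice_supporting_functional[OF \<Omega>(1,3) p0 bD] by metis
    have R: "norm (v - ?c) \<le> R" if "v \<in> closure ?D" for v
      using hslice_norm_le_diamH[OF \<Omega>(2) p0 that] by (simp add: R_def)
    have "0 < R"
    proof -
      have "?c \<in> ?D" using p0 by (simp add: hslice_def)
      then obtain \<epsilon> where \<epsilon>: "0 < \<epsilon>" "cball ?c \<epsilon> \<subseteq> ?D"
        using open_hslice[OF \<Omega>(1)] open_contains_cball_eq by metis
      have "?c + \<epsilon> *\<^sub>R e \<in> cball ?c \<epsilon>" using e \<epsilon>(1) by (simp add: dist_norm)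
      then have "?c + \<epsilon> *\<^sub>R e \<in> closure ?D" using \<epsilon>(2) closure_subset by blast
      from R[OF this] show ?thesis using e \<epsilon>(1) by simp
    qed
    \<comment> \<open>The budget U is split in halves: the part of the slope along \<open>e\<close>
      contributes at most h d = U/2, the deviation from the axis less than r R = U/2.\<close>
    define r where "r = U / (2 * R)"
    define h where "h = U / (2 * d)"
    have r: "0 < r" "r * R = U / 2" using U \<open>0 < R\<close> by (auto simp: r_def)
    have h: "0 \<le> h" "h * d = U / 2" using U d by (auto simp: h_def)
    have tube: "(\<Union>\<alpha>\<in>{0..h}. ball (\<alpha> *\<^sub>R e) r) \<subseteq> H_subdiff_set \<Omega> u (\<Omega> \<inter> hplane p0)"
    proof
      fix p assume "p \<in> (\<Union>\<alpha>\<in>{0..h}. ball (\<alpha> *\<^sub>R e) r)"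
      then obtain \<alpha> where \<alpha>: "0 \<le> \<alpha>" "\<alpha> \<le> h" "norm (p - \<alpha> *\<^sub>R e) < r"
        by (auto simp: dist_norm norm_minus_commute)
      show "p \<in> H_subdiff_set \<Omega> u (\<Omega> \<inter> hplane p0)"
      proof (rule H_subdiff_polar[OF \<Omega>(1,3,4,5) p0 bD])
        show "\<And>p. p \<in> frontier \<Omega> \<Longrightarrow> u p = 0" using zero by blast
        fix v assume v: "v \<in> closure ?D"
        have "\<alpha> * (e \<bullet> (v - ?c)) \<le> \<alpha> * d" using ed[OF v] \<alpha>(1) by (rule mult_left_mono)
        also have "\<dots> \<le> U / 2" using \<alpha>(2) d(1) h(2) by (metis less_imp_le mult_right_mono)
        finally have 1: "\<alpha> * (e \<bullet> (v - ?c)) \<le> U / 2" .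
        have "(p - \<alpha> *\<^sub>R e) \<bullet> (v - ?c) \<le> norm (p - \<alpha> *\<^sub>R e) * norm (v - ?c)"
          by (rule norm_cauchy_schwarz)
        also have "\<dots> \<le> norm (p - \<alpha> *\<^sub>R e) * R"
          by (intro mult_left_mono R v) simp
        also have "\<dots> < r * R" using \<alpha>(3) \<open>0 < R\<close> by simp
        finally have 2: "(p - \<alpha> *\<^sub>R e) \<bullet> (v - ?c) < U / 2" using r(2) by simp
        have "p \<bullet> (v - ?c) = (p - \<alpha> *\<^sub>R e) \<bullet> (v - ?c) + \<alpha> * (e \<bullet> (v - ?c))"
          by (simp add: inner_diff_left)
        with 1 2 show "p \<bullet> (v - ?c) < - u p0" by (simp add: U_def)
      qed
    qed
    let ?m = "h / (2 * r) * (\<beta> * r ^ ?N)"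
    have m: "ennreal ?m \<le> lebesgue_outer (H_subdiff_set \<Omega> u (\<Omega> \<inter> hplane p0))"
    proof (rule lebesgue_outer_ge)
      fix B assume "B \<in> sets lebesgue" "H_subdiff_set \<Omega> u (\<Omega> \<inter> hplane p0) \<subseteq> B"
      then show "ennreal ?m \<le> emeasure lebesgue B"
        using emeasure_tube_ge[OF e r(1) h(1), of B] tube unfolding N \<beta>_def by blast
    qed
    have RN: "R ^ ?N = R * R ^ (?N - 1)" using N0 by (metis power_eq_if less_not_refl)
    have hr: "h / (2 * r) = R / (2 * d)"
      using U \<open>0 < R\<close> d(1) by (simp add: h_def r_def field_simps)
    have rN: "r ^ ?N = U ^ ?N / (2 ^ ?N * (R * R ^ (?N - 1)))"
      unfolding r_def power_divide power_mult_distrib RN ..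
    have "U ^ ?N = C * d * R ^ (?N - 1) * ?m"
      unfolding C_def hr rN power_add using \<open>0 < R\<close> d(1) \<beta> by (simp add: divide_simps)
    then have "ennreal (\<bar>u p0\<bar> ^ ?N) = ennreal (C * d * R ^ (?N - 1) * ?m)"
      by (simp only: U(2))
    also have "\<dots> = ennreal (C * d * R ^ (?N - 1)) * ennreal ?m"
      using C d(1) \<open>0 < R\<close> \<beta> h(1) r(1) by (intro ennreal_mult) auto
    also have "\<dots> \<le> ennreal (C * distH p0 (frontier \<Omega> \<inter> hplane p0) * R ^ (?N - 1)) *
        lebesgue_outer (H_subdiff_set \<Omega> u (\<Omega> \<inter> hplane p0))"
      using C d(2) \<open>0 < R\<close>
      by (intro mult_mono m ennreal_leI mult_right_mono mult_left_mono) auto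
    finally show ?thesis unfolding R_def .
  qed
  then show ?thesis using C by blast
qed

end
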